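(* Let $a,b$ be positive integers, let $\alpha=[\overline{a,b}]$ be the periodic continued fraction of period $2$, and let $r_n=p_n/q_n$ be the $n$-th convergent of $\alpha$. Set $$A=\begin{pmatrix}ab+1&a\\ b&1\end{pmatrix}=\begin{pmatrix}p_1&p_0\\ q_1&q_0\end{pmatrix},$$ with eigenvalues $u>1/u$. Then $$\mathcal{L}\bigl(1/(b\alpha+1)^2\bigr)=\mathcal{L}(1/u^2)=\sum_{n=2}^{\infty}\mathcal{L}\left(\left(\frac{b}{q_{2n-1}}\right)^2\right).$$
   Context: The Rogers dilogarithm is the function on $[0,1]$ given by $\mathcal{L}(z)=\mathrm{Li}_2(z)+\frac12\log|z|\log(1-z)$, where $\mathrm{Li}_2(z)=\sum_{n\ge1}z^n/n^2$, with $\mathcal{L}(0)=0$ and $\mathcal{L}(1)=\pi^2/6$. For positive integers $a_0,a_1,\dots$, $[a_0,a_1,a_2,\dots]=a_0+\cfrac{1}{a_1+\cfrac{1}{a_2+\cdots}}$, and $[\overline{a,b}]=[a,b,a,b,\dots]$, i.e. $a_n=a$ for $n$ even and $a_n=b$ for $n$ odd. The convergents $p_n/q_n=[a_0,\dots,a_n]$ are given by $p_n=a_np_{n-1}+p_{n-2}$, $q_n=a_nq_{n-1}+q_{n-2}$ for $n\ge0$, with $(p_{-2},p_{-1})=(0,1)$ and $(q_{-2},q_{-1})=(1,0)$. *)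

theory Defs
  imports Complex_Main "Jordan_Normal_Form.Spectral_Radius"
begin

definition dilog :: "real \<Rightarrow> real" where
  "dilog z = (\<Sum>n. z ^ Suc n / real (Suc n) ^ 2)"

text \<open>Only meaningful on the interval \<open>[0,1]\<close>.\<close>

definition rogers_dilog :: "real \<Rightarrow> real" where
  "rogers_dilog z =
     (if z = 0 then 0 else if z = 1 then pi\<^sup>2 / 6
      else dilog z + 1 / 2 * ln \<bar>z\<bar> * ln (1 - z))"

primrec cfrac_fin :: "(nat \<Rightarrow> nat) \<Rightarrow> nat \<Rightarrow> real" where
  "cfrac_fin c 0 = real (c 0)"
| "cfrac_fin c (Suc n) = real (c 0) + 1 / cfrac_fin (\<lambda>k. c (Suc k)) n"

definition cfrac :: "(nat \<Rightarrow> nat) \<Rightarrow> real" where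
  "cfrac c = lim (cfrac_fin c)"

text \<open>The recurrences for \<open>p\<close> and \<open>q\<close> start at index \<open>-2\<close>; here the index is shifted by 2,
  so \<open>x\<close> and \<open>y\<close> are the values at \<open>-2\<close> and \<open>-1\<close>.\<close>

fun cfrac_rec :: "nat \<Rightarrow> nat \<Rightarrow> (nat \<Rightarrow> nat) \<Rightarrow> nat \<Rightarrow> nat" where
  "cfrac_rec x y c 0 = x"
| "cfrac_rec x y c (Suc 0) = y"
| "cfrac_rec x y c (Suc (Suc n)) = c n * cfrac_rec x y c (Suc n) + cfrac_rec x y c n"

definition conv_num :: "(nat \<Rightarrow> nat) \<Rightarrow> nat \<Rightarrow> nat" where
  "conv_num c n = cfrac_rec 0 1 c (n + 2)"

definition conv_denom :: "(nat \<Rightarrow> nat) \<Rightarrow> nat \<Rightarrow> nat" where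
  "conv_denom c n = cfrac_rec 1 0 c (n + 2)"

definition periodic2 :: "nat \<Rightarrow> nat \<Rightarrow> nat \<Rightarrow> nat" where
  "periodic2 a b n = (if even n then a else b)"

lemma cfrac_rec_shift:
  "cfrac_rec 1 0 c (Suc n) = cfrac_rec 0 1 (\<lambda>k. c (Suc k)) n"
  "cfrac_rec 0 1 c (Suc n) =
     c 0 * cfrac_rec 0 1 (\<lambda>k. c (Suc k)) n + cfrac_rec 1 0 (\<lambda>k. c (Suc k)) n"
  by (induction n rule: induct_nat_012) (auto simp: algebra_simps)

lemma conv_num_pos: "(\<And>n. c n > 0) \<Longrightarrow> conv_num c n > 0"
proof -
  assume pos: "\<And>n. c n > 0"
  have "cfrac_rec 0 1 c (Suc n) > 0" for n
    by (induction n) (use pos in auto)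
  from this[of "Suc n"] show ?thesis by (simp add: conv_num_def)
qed

lemma cfrac_fin_eq_convergent:
  assumes "\<And>n. c n > 0"
  shows "cfrac_fin c n = real (conv_num c n) / real (conv_denom c n)"
  using assms
proof (induction n arbitrary: c)
  case 0
  then show ?case by (simp add: conv_num_def conv_denom_def numeral_2_eq_2)
next
  case (Suc n)
  let ?c = "\<lambda>k. c (Suc k)"
  have "conv_num ?c n > 0" using Suc.prems by (intro conv_num_pos) auto
  moreover have "conv_denom c (Suc n) = conv_num ?c n"
      "conv_num c (Suc n) = c 0 * conv_num ?c n + conv_denom ?c n"
    unfolding conv_num_def conv_denom_def add_Suc by (rule cfrac_rec_shift)+
  moreover have "cfrac_fin ?c n = real (conv_num ?c n) / real (conv_denom ?c n)"
    using Suc.prems by (intro Suc.IH) auto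
  ultimately show ?case by (simp add: field_simps)
qed

end

theory Submission
  imports Defs "HOL-Real_Asymp.Real_Asymp"
begin

text \<open>Writing \<open>x = 1/u\<^sup>2\<close>, the recurrence for \<open>q\<^bsub>2n-1\<^esub>\<close> with characteristic roots \<open>u\<close> and \<open>1/u\<close> gives
  \<open>(b / q\<^bsub>2n-1\<^esub>)\<^sup>2 = x\<^bsup>n-1\<^esup> ((1 - x) / (1 - x\<^sup>n))\<^sup>2\<close>, and the five-term relation for the Rogers dilogarithm
  makes the series over these arguments telescope to \<open>\<L>(x)\<close>. Only the constancy of
  \<open>\<L>(z) + \<L>(1 - z)\<close> enters, not its value \<open>\<pi>\<^sup>2/6\<close>. Finally \<open>u = b\<alpha> + 1\<close>, because \<open>\<alpha>\<close> is the
  attracting fixed point of the Moebius transformation of \<open>A\<close>.\<close>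

section \<open>Derivative and continuity of the Rogers dilogarithm\<close>

text \<open>Termwise differentiation inside the disc of convergence. The derivative stays a series
  so that \<open>z = 0\<close> is covered too, which gives continuity of \<open>dilog\<close>
  there.\<close>

lemma dilog_has_field_derivative_suminf:
  assumes "\<bar>z\<bar> < 1"
  shows "(dilog has_field_derivative (\<Sum>n. z ^ n / real (Suc n))) (at z)"
proof -
  \<comment> \<open>Since \<open>1 / 0 = 0\<close>, the coefficient at \<open>n = 0\<close>
    vanishes, so this power series agrees with the shifted one in \<open>dilog\<close>.\<close>
  let ?c = "\<lambda>n. 1 / real n ^ 2"
  have summ: "summable (\<lambda>n. ?c n * x ^ n)" if "norm x < 1" for x :: real
  proof (rule summable_comparison_test[OF _ summable_geometric[of "norm x"]])
    have "norm (?c n * x ^ n) \<le> norm x ^ n" for n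
      by (cases "n = 0") (auto simp: abs_mult power_abs divide_simps mult_le_cancel_left1)
    then show "\<exists>N. \<forall>n\<ge>N. norm (?c n * x ^ n) \<le> norm x ^ n" by blast
  qed (use that in auto)
  have "((\<lambda>z. \<Sum>n. ?c n * z ^ n) has_field_derivative (\<Sum>n. diffs ?c n * z ^ n)) (at z)"
    by (rule termdiffs_strong'[where K = 1]) (use assms summ in auto)
  moreover have "diffs ?c n * z ^ n = z ^ n / real (Suc n)" for n
    by (simp add: diffs_def power2_eq_square del: of_nat_Suc)
  moreover have "eventually (\<lambda>x. x \<in> {-1<..<1}) (nhds z)"
    using assms by (intro eventually_nhds_in_open) auto
  then have "eventually (\<lambda>x. dilog x = (\<Sum>n. ?c n * x ^ n)) (nhds z)"
  proof eventually_elim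
    case (elim x)
    then show ?case using suminf_split_head[OF summ[of x]] by (auto simp add: dilog_def)
  qed
  ultimately show ?thesis by (subst DERIV_cong_ev[OF refl _ refl]) auto
qed

lemma dilog_has_field_derivative:
  assumes "0 < z" "z < 1"
  shows "(dilog has_field_derivative - ln (1 - z) / z) (at z)"
proof -
  have "summable (\<lambda>n. z ^ n / real (Suc n))"
  proof (rule summable_comparison_test[OF _ summable_geometric[of z]])
    have "norm (z ^ n / real (Suc n)) \<le> z ^ n" for n
      using assms by (simp add: divide_simps mult_left_le)
    then show "\<exists>N. \<forall>n\<ge>N. norm (z ^ n / real (Suc n)) \<le> z ^ n" by blast
  qed (use assms in auto)
  have "ln (1 - z) = (\<Sum>n. (-1) ^ n * (1 / real (n + 1)) * (1 - z - 1) ^ Suc n)"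
    by (rule ln_series) (use assms in auto)
  also have "\<dots> = (\<Sum>n. - z * (z ^ n / real (Suc n)))"
  proof (rule suminf_cong)
    fix n
    have "(-1) ^ n * (- z) ^ n = z ^ n"
      by (simp flip: power_mult_distrib)
    then show "(-1) ^ n * (1 / real (n + 1)) * (1 - z - 1) ^ Suc n = - z * (z ^ n / real (Suc n))"
      by (simp add: field_simps)
  qed
  also have "\<dots> = - z * (\<Sum>n. z ^ n / real (Suc n))"
    by (rule suminf_mult) fact
  finally have "(\<Sum>n. z ^ n / real (Suc n)) = - ln (1 - z) / z"
    using assms by (simp add: field_simps)
  then show ?thesis
    using dilog_has_field_derivative_suminf[of z] assms by simp
qed

lemma rogers_dilog_has_field_derivative:
  assumes "0 < z" "z < 1"
  shows "(rogers_dilog has_field_derivative - (ln (1 - z) / z + ln z / (1 - z)) / 2) (at z)"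
proof -
  have "((\<lambda>z. dilog z + 1 / 2 * ln z * ln (1 - z)) has_field_derivative
      - (ln (1 - z) / z + ln z / (1 - z)) / 2) (at z)"
    using assms
    by (auto intro!: derivative_eq_intros dilog_has_field_derivative simp: field_simps)
  moreover have "eventually (\<lambda>x. x \<in> {0<..<1}) (nhds z)"
    using assms by (intro eventually_nhds_in_open) auto
  then have "eventually (\<lambda>x. rogers_dilog x = dilog x + 1 / 2 * ln x * ln (1 - x)) (nhds z)"
    by eventually_elim (auto simp: rogers_dilog_def)
  ultimately show ?thesis by (subst DERIV_cong_ev[OF refl _ refl]) auto
qed

text \<open>The chain rule, arranged so that each logarithm multiplies a logarithmic derivative:
  \<open>f' / f\<close> is that of \<open>f\<close>, and \<open>f' / (1 - f)\<close> is minus that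
  of \<open>1 - f\<close>. Products inside the logarithms then become sums.\<close>

lemma rogers_dilog_has_field_derivative' [derivative_intros]:
  assumes "(f has_field_derivative f') (at x within A)" "0 < f x" "f x < 1"
  shows "((\<lambda>x. rogers_dilog (f x)) has_field_derivative
    - (ln (1 - f x) * (f' / f x) + ln (f x) * (f' / (1 - f x))) / 2) (at x within A)"
  using DERIV_chain2[OF rogers_dilog_has_field_derivative[OF assms(2,3)] assms(1)]
  by (rule DERIV_cong) (simp add: algebra_simps add_divide_distrib)

lemma rogers_dilog_0 [simp]: "rogers_dilog 0 = 0"
  by (simp add: rogers_dilog_def)

text \<open>The endpoint 0 is the base point for the five-term relation and a limit point in the
  telescoping sum. Continuity there holds because \<open>ln x * ln (1 - x)\<close> tends to
  0.\<close>

lemma continuous_on_rogers_dilog: "continuous_on {0..<1} rogers_dilog"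
proof -
  have "(rogers_dilog \<longlongrightarrow> 0) (at_right 0)"
  proof -
    have "isCont dilog 0"
      by (rule DERIV_isCont[OF dilog_has_field_derivative_suminf]) simp
    then have "(dilog \<longlongrightarrow> 0) (at_right 0)"
      by (auto simp: isCont_def dilog_def intro: tendsto_mono[OF at_le])
    moreover have "((\<lambda>x::real. 1 / 2 * ln x * ln (1 - x)) \<longlongrightarrow> 0) (at_right 0)"
      by real_asymp
    ultimately have "((\<lambda>x. dilog x + 1 / 2 * ln x * ln (1 - x)) \<longlongrightarrow> 0) (at_right 0)"
      using tendsto_add by fastforce
    moreover have "eventually (\<lambda>x::real. x \<in> {0<..<1}) (at_right 0)"
      by (rule eventually_at_right_real) simp
    then have "eventually (\<lambda>x. dilog x + 1 / 2 * ln x * ln (1 - x) = rogers_dilog x) (at_right 0)"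
      by eventually_elim (auto simp: rogers_dilog_def)
    ultimately show ?thesis by (rule Lim_transform_eventually)
  qed
  moreover have "at 0 within {0..<1} \<le> at 0 within {0..1::real}"
    by (rule at_le) auto
  then have "at 0 within {0..<1} \<le> at_right (0::real)"
    by (simp add: at_within_Icc_at_right)
  ultimately have "continuous (at 0 within {0..<1}) rogers_dilog"
    unfolding continuous_within rogers_dilog_0 by (rule tendsto_mono[rotated])
  moreover have "isCont rogers_dilog x" if "0 < x" "x < 1" for x
    by (rule DERIV_isCont[OF rogers_dilog_has_field_derivative]) fact+
  then have "continuous (at x within {0..<1}) rogers_dilog" if "0 < x" "x < 1" for x
    using that by (blast intro: continuous_at_imp_continuous_at_within)
  ultimately show ?thesis
    unfolding continuous_on_eq_continuous_within by (metis atLeastLessThan_iff less_eq_real_def)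
qed

lemmas continuous_on_rogers_dilog' [continuous_intros] =
  continuous_on_compose2[OF continuous_on_rogers_dilog]

section \<open>Functional equations and the telescoping series\<close>

text \<open>The derivative of \<open>rogers_dilog\<close> is invariant under \<open>z\<close> to
  \<open>1 - z\<close>, so the two contributions to the derivative of the sum cancel.\<close>

lemma rogers_dilog_reflection:
  assumes "0 < x" "x < 1" "0 < y" "y < 1"
  shows "rogers_dilog x + rogers_dilog (1 - x) = rogers_dilog y + rogers_dilog (1 - y)"
proof (rule DERIV_isconst3[of 0 1 x y "\<lambda>x. rogers_dilog x + rogers_dilog (1 - x)"])
  fix z :: real
  assume "z \<in> {0<..<1}"
  then show "((\<lambda>x. rogers_dilog x + rogers_dilog (1 - x)) has_field_derivative 0) (at z)"
    by (auto intro!: derivative_eq_intros simp: field_simps)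
qed (use assms in auto)

text \<open>With \<open>y\<close> fixed, the terms depending on \<open>x\<close> are collected in
  \<open>?G\<close>, whose derivative vanishes. The constant is found at
  \<open>x = 0\<close>.\<close>

theorem rogers_dilog_five_term:
  assumes x: "0 < x" "x < 1" and y: "0 < y" "y < 1"
  shows "rogers_dilog x + rogers_dilog y =
    rogers_dilog (x * y) + rogers_dilog (x * (1 - y) / (1 - x * y)) +
    rogers_dilog (y * (1 - x) / (1 - x * y))"
proof -
  let ?P = "\<lambda>x. x * (1 - y) / (1 - x * y)" and ?R = "\<lambda>x. y * (1 - x) / (1 - x * y)"
  let ?G = "\<lambda>x. rogers_dilog x - rogers_dilog (x * y) - rogers_dilog (?P x) - rogers_dilog (?R x)"
  have pos: "0 < 1 - t * y" if "0 \<le> t" "t < 1" for t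
  proof -
    have "t * y < 1 * 1" by (rule mult_strict_mono) (use that y in auto)
    then show ?thesis by simp
  qed
  \<comment> \<open>These complements factor, so every logarithm that occurs is a combination of
    those of \<open>t\<close>, \<open>1 - t\<close>, \<open>y\<close>, \<open>1 - y\<close> and
    \<open>1 - t * y\<close>.\<close>
  have P: "1 - ?P t = (1 - t) / (1 - t * y)" and R: "1 - ?R t = (1 - y) / (1 - t * y)"
    if "0 \<le> t" "t < 1" for t using pos[OF that] by (auto simp: field_simps)
  have P01: "0 \<le> ?P t" "?P t < 1" and R01: "0 \<le> ?R t" "?R t < 1" and xy01: "0 \<le> t * y" "t * y < 1"
    if "0 \<le> t" "t < 1" for t
  proof -
    have "0 < 1 - ?P t" "0 < 1 - ?R t"
      unfolding P[OF that] R[OF that] using that y pos[OF that] by (auto intro: divide_pos_pos)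
    then show "?P t < 1" "?R t < 1" by linarith+
  qed (use that y pos[OF that] in \<open>auto intro: divide_nonneg_pos\<close>)
  \<comment> \<open>At 0 three of the four terms vanish and \<open>?R 0 = y\<close>, so
    \<open>?G 0\<close> is \<open>- rogers_dilog y\<close>.\<close>
  have "?G x = ?G 0"
  proof (rule DERIV_isconst_end[OF x(1)])
    have "t < 1" if "t \<le> x" for t using that x by simp
    then show "continuous_on {0..x} ?G"
      using P01 R01 xy01 pos x
      by (auto intro!: continuous_intros simp: less_imp_neq[symmetric])
  next
    fix t assume "0 < t" "t < x"
    then have t: "0 < t" "t < 1" using x by auto
    have t': "1 - t * y > 0" "0 < t * y" "t * y < 1" "0 < ?P t" "?P t < 1" "0 < ?R t" "?R t < 1"
      using t y pos[of t] P01[of t] R01[of t] by auto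
    have dP: "(?P has_field_derivative (1 - y) / (1 - t * y)\<^sup>2) (at t)"
      using t' by (auto intro!: derivative_eq_intros simp: power2_eq_square) (simp add: algebra_simps)
    have dR: "(?R has_field_derivative (y * y - y) / (1 - t * y)\<^sup>2) (at t)"
      using t' by (auto intro!: derivative_eq_intros simp: power2_eq_square) (simp add: algebra_simps)
    have lnP: "ln (?P t) = ln t + ln (1 - y) - ln (1 - t * y)"
        "ln (1 - ?P t) = ln (1 - t) - ln (1 - t * y)"
      and lnR: "ln (?R t) = ln y + ln (1 - t) - ln (1 - t * y)"
        "ln (1 - ?R t) = ln (1 - y) - ln (1 - t * y)"
      unfolding P[OF less_imp_le[OF t(1)] t(2)] R[OF less_imp_le[OF t(1)] t(2)]
      using t t' y by (simp_all add: ln_mult ln_div)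
    \<comment> \<open>Up to sign, the logarithmic derivatives in \<open>t\<close> of
      \<open>t\<close>, \<open>1 - t\<close> and \<open>1 - t * y\<close>. In these terms the
      vanishing of the derivative is a polynomial identity in the logarithms and \<open>r\<close>,
      \<open>s\<close>, \<open>w\<close>.\<close>
    define r s w where "r = 1 / t" and "s = 1 / (1 - t)" and "w = y / (1 - t * y)"
    have alg: "(1 - y) / (1 - t * y)\<^sup>2 / ?P t = r + w"
        "(1 - y) / (1 - t * y)\<^sup>2 / (1 - ?P t) = s - w"
        "(y * y - y) / (1 - t * y)\<^sup>2 / ?R t = w - s"
        "(y * y - y) / (1 - t * y)\<^sup>2 / (1 - ?R t) = - w"
      unfolding P[OF less_imp_le[OF t(1)] t(2)] R[OF less_imp_le[OF t(1)] t(2)] r_def s_def w_def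
      using t t' y by (simp_all add: divide_simps power2_eq_square) (simp_all add: algebra_simps)
    have dM: "((\<lambda>t. t * y) has_field_derivative y) (at t)"
      by (auto intro!: derivative_eq_intros)
    have "(?G has_field_derivative
        - (ln (1 - t) * (1 / t) + ln t * (1 / (1 - t))) / 2
        - (- (ln (1 - t * y) * (y / (t * y)) + ln (t * y) * (y / (1 - t * y))) / 2)
        - (- (ln (1 - ?P t) * ((1 - y) / (1 - t * y)\<^sup>2 / ?P t)
              + ln (?P t) * ((1 - y) / (1 - t * y)\<^sup>2 / (1 - ?P t))) / 2)
        - (- (ln (1 - ?R t) * ((y * y - y) / (1 - t * y)\<^sup>2 / ?R t)
              + ln (?R t) * ((y * y - y) / (1 - t * y)\<^sup>2 / (1 - ?R t))) / 2)) (at t)"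
      by (intro DERIV_diff rogers_dilog_has_field_derivative' DERIV_ident dM dP dR t t')
    moreover have m: "y / (t * y) = r" "ln (t * y) = ln t + ln y"
      using t y by (simp_all add: r_def ln_mult)
    ultimately show "(?G has_field_derivative 0) (at t)"
      unfolding alg lnP lnR m r_def[symmetric] s_def[symmetric] w_def[symmetric]
      by (elim DERIV_cong) (simp add: algebra_simps add_divide_distrib diff_divide_distrib)
  qed
  then show ?thesis by simp
qed

text \<open>The points \<open>X\<^sub>n = (1 - x) / (1 - x\<^bsup>n+2\<^esup>)\<close> and \<open>Y\<^sub>n = x\<^bsup>n+1\<^esup> X\<^sub>n\<close> are chosen such that the five-term
  relation at \<open>(X\<^sub>n, Y\<^sub>n)\<close> returns the next pair \<open>(X\<^sub>n\<^sub>+\<^sub>1, Y\<^sub>n\<^sub>+\<^sub>1)\<close>, so that the series telescopes. The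
  remaining boundary terms combine because \<open>X\<^sub>0 + Y\<^sub>0 = 1\<close> and \<open>X\<^sub>n\<close> tends to \<open>1 - x\<close>.\<close>

lemma rogers_dilog_sums:
  assumes x: "0 < x" "x < 1"
  shows "(\<lambda>n. rogers_dilog (x ^ Suc n * ((1 - x) / (1 - x ^ (n + 2)))\<^sup>2)) sums rogers_dilog x"
proof -
  define X Y where "X n = (1 - x) / (1 - x ^ (n + 2))"
    and "Y n = x ^ Suc n * (1 - x) / (1 - x ^ (n + 2))" for n
  let ?F = "\<lambda>n. rogers_dilog (X n) + rogers_dilog (Y n)"
  have pow: "0 < x ^ (n + 2)" "x ^ (n + 2) < x" "0 < x ^ Suc n" "x ^ Suc n < 1" for n
    using x power_strict_decreasing[of 1 "n + 2" x] by (auto intro: power_Suc_less_one)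
  have X: "0 < X n" "X n < 1" for n
    using x pow[of n] by (auto simp: X_def divide_simps)
  have YX: "Y n = x ^ Suc n * X n" for n
    by (simp add: X_def Y_def)
  have Y: "0 < Y n" "Y n < 1" for n
    unfolding YX using mult_strict_mono[of "x ^ Suc n" 1 "X n" 1] X[of n] pow[of n] by auto
  have step: "?F n - ?F (Suc n) = rogers_dilog (x ^ Suc n * ((1 - x) / (1 - x ^ (n + 2)))\<^sup>2)" for n
  proof -
    \<comment> \<open>With \<open>x ^ n\<close> abstracted to \<open>z\<close>, the identities
      between neighbouring indices become rational identities in \<open>x\<close> and
      \<open>z\<close>.\<close>
    define z where "z = x ^ n"
    have z: "0 < z" "x * z < 1" "x * (x * z) < x" "x * (x * z) < 1" "x * (x * (x * z)) < 1"
      using x pow[of n] pow[of "Suc n"] by (auto simp: z_def)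
    have Xz: "X n = (1 - x) / (1 - x * (x * z))" "Y n = x * z * (1 - x) / (1 - x * (x * z))"
      "X (Suc n) = (1 - x) / (1 - x * (x * (x * z)))"
      "Y (Suc n) = x * (x * z) * (1 - x) / (1 - x * (x * (x * z)))"
      by (simp_all add: X_def Y_def z_def)
    \<comment> \<open>The factor \<open>1 - x * z\<close> is common to all three numerators and
      cancels in the five-term arguments, leaving the denominator of index
      \<open>Suc n\<close>.\<close>
    have "1 - X n = x * (1 - x * z) / (1 - x * (x * z))" "1 - Y n = (1 - x * z) / (1 - x * (x * z))"
      "1 - X n * Y n = (1 - x * z) * (1 - x * (x * (x * z))) / (1 - x * (x * z))\<^sup>2"
      unfolding Xz using x z by (simp_all add: divide_simps power2_eq_square) (simp_all add: algebra_simps)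
    then have "X n * (1 - Y n) / (1 - X n * Y n) = X (Suc n)"
      "Y n * (1 - X n) / (1 - X n * Y n) = Y (Suc n)"
      using x z by (simp_all add: Xz power2_eq_square)
    moreover have "X n * Y n = x ^ Suc n * ((1 - x) / (1 - x ^ (n + 2)))\<^sup>2"
      by (simp add: X_def Y_def power2_eq_square)
    ultimately show ?thesis
      using rogers_dilog_five_term[OF X Y, of n n] by simp
  qed
  have "?F \<longlonglongrightarrow> rogers_dilog (1 - x) + rogers_dilog 0"
  proof (intro tendsto_add continuous_on_tendsto_compose[OF continuous_on_rogers_dilog])
    have "(\<lambda>n. x ^ n) \<longlonglongrightarrow> 0"
      using x by (intro LIMSEQ_realpow_zero) auto
    then have lim: "(\<lambda>n. x ^ (n + 2)) \<longlonglongrightarrow> 0" "(\<lambda>n. x ^ (n + 1)) \<longlonglongrightarrow> 0"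
      by (rule LIMSEQ_ignore_initial_segment)+
    then have "X \<longlonglongrightarrow> (1 - x) / (1 - 0)"
      unfolding X_def by (intro tendsto_intros) auto
    then show *: "X \<longlonglongrightarrow> 1 - x" by simp
    then have "Y \<longlonglongrightarrow> 0 * (1 - x)"
      unfolding YX using lim(2) by (intro tendsto_mult) auto
    then show "Y \<longlonglongrightarrow> 0" by simp
  qed (use x X Y in \<open>auto simp: less_imp_le\<close>)
  then have "(\<lambda>n. ?F n - ?F (Suc n)) sums (?F 0 - (rogers_dilog (1 - x) + rogers_dilog 0))"
    by (rule telescope_sums')
  moreover have "Y 0 = 1 - X 0"
  proof -
    have "x * x < 1" using mult_strict_mono[of x 1 x 1] x by simp
    then show ?thesis by (simp add: X_def Y_def divide_simps power2_eq_square) (simp add: algebra_simps)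
  qed
  ultimately show ?thesis
    unfolding step using rogers_dilog_reflection[OF X x, of 0] by simp
qed

section \<open>Convergent denominators and the value of the continued fraction\<close>

text \<open>Binet's formula for characteristic roots \<open>u\<close> and \<open>w\<close>,
  multiplied out by \<open>u - w\<close> so that it holds in any commutative ring.\<close>

lemma second_order_recurrence:
  fixes s :: "nat \<Rightarrow> 'a :: comm_ring_1"
  assumes "u * w = 1" "s 0 = 0" "\<And>n. s (n + 2) = (u + w) * s (n + 1) - s n"
  shows "s n * (u - w) = s 1 * (u ^ n - w ^ n)"
proof (induction n rule: induct_nat_012)
  case (ge2 n)
  have "s (Suc (Suc n)) * (u - w) = (u + w) * (s (Suc n) * (u - w)) - s n * (u - w)"
    using assms(3)[of n] by (simp add: left_diff_distrib mult.assoc)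
  also have "\<dots> = s 1 * ((u + w) * (u ^ Suc n - w ^ Suc n) - (u ^ n - w ^ n))"
    unfolding ge2 by (simp add: algebra_simps)
  also have "(u + w) * (u ^ Suc n - w ^ Suc n) = u ^ Suc (Suc n) - w ^ Suc (Suc n) + (u * w) * (u ^ n - w ^ n)"
    by (simp add: algebra_simps)
  finally show ?case by (simp add: assms(1))
qed (use assms(2) in auto)

text \<open>Eliminating the even positions leaves a recurrence with the trace
  \<open>a * b + 2\<close> and determinant 1 of the period matrix. The additive form avoids
  subtraction on naturals; with the index shift of 2, position \<open>2 * n + 1\<close> holds the
  entry of index \<open>2 * n - 1\<close>.\<close>

lemma cfrac_rec_periodic2:
  "cfrac_rec x y (periodic2 a b) (2 * (n + 2) + 1) + cfrac_rec x y (periodic2 a b) (2 * n + 1) =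
    (a * b + 2) * cfrac_rec x y (periodic2 a b) (2 * (n + 1) + 1)"
  by (simp add: periodic2_def algebra_simps)

lemma conv_denom_periodic2:
  assumes u: "u * w = 1" "u + w = real (a * b + 2)"
  shows "real (conv_denom (periodic2 a b) (2 * Suc n - 1)) * (u - w) = real b * (u ^ Suc n - w ^ Suc n)"
proof -
  \<comment> \<open>The initial values are 0 (index -1) and \<open>b\<close> (index 1), which
    produces the factor \<open>b\<close>.\<close>
  let ?s = "\<lambda>n. real (cfrac_rec 1 0 (periodic2 a b) (2 * n + 1))"
  have "?s (n + 2) + ?s n = real (a * b + 2) * ?s (n + 1)" for n
    using cfrac_rec_periodic2[of 1 0 a b n] by (metis of_nat_add of_nat_mult)
  then have "?s (n + 2) = (u + w) * ?s (n + 1) - ?s n" for n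
    unfolding u(2) by (metis add_diff_cancel_right')
  from second_order_recurrence[of u w ?s, OF u(1) _ this, of "Suc n"]
  show ?thesis by (simp add: conv_denom_def periodic2_def numeral_3_eq_3)
qed

lemma cfrac_fin_pos:
  assumes "\<And>n. c n > 0"
  shows "cfrac_fin c n > 0"
  using assms by (induction n arbitrary: c) (auto intro!: add_pos_pos)

text \<open>Prepending one period is a Moebius map of determinant 1 that fixes
  \<open>(u - 1) / b\<close>. Distances to this point shrink by at least the factor \<open>w\<close>
  every two steps.\<close>

lemma cfrac_periodic2:
  assumes ab: "a > 0" "b > 0" and u: "u * w = 1" "u + w = real (a * b + 2)" "1 < u"
  shows "cfrac (periodic2 a b) = (u - 1) / real b"
proof -
  define f where "f = cfrac_fin (periodic2 a b)"
  define \<beta> where "\<beta> = (u - 1) / real b"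
  have w: "w = 1 / u" "0 < w" "w < 1"
  proof -
    show "w = 1 / u" using u(1,3) by (simp add: field_simps)
    then show "0 < w" "w < 1" using u(3) by simp_all
  qed
  have pos: "f n > 0" for n
    unfolding f_def by (rule cfrac_fin_pos) (use ab in \<open>auto simp: periodic2_def\<close>)
  have f_step: "f (Suc (Suc n)) = a + 1 / (b + 1 / f n)" for n
    by (simp add: f_def periodic2_def[abs_def])
  have \<beta>: "\<beta> > 0" "b * \<beta> + 1 = u"
    using ab u by (auto simp: \<beta>_def)
  \<comment> \<open>Scaling by \<open>b\<close> allows \<open>b * \<beta> = u - 1\<close> to be
    substituted; the fixed-point equation then reduces to \<open>u * w = 1\<close>.\<close>
  have "b * ((a * b + 1) * \<beta> + a) = b * (u * \<beta>)"
  proof -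
    have "b * ((a * b + 1) * \<beta> + a) = (real (a * b) + 1) * (b * \<beta>) + real (a * b)"
      by (simp add: algebra_simps)
    also have b\<beta>: "b * \<beta> = u - 1" using \<beta>(2) by simp
    also have "real (a * b) = u + w - 2" using u(2) by simp
    also have "(u + w - 2 + 1) * (u - 1) + (u + w - 2) = (u + w - 1) * (u - 1) + (u + w - 2)"
      by simp
    also have "\<dots> = u * (u - 1) + (u * w - 1)" by (simp add: algebra_simps)
    also have "\<dots> = b * (u * \<beta>)" unfolding u(1) mult.left_commute[of "real b"] b\<beta> by simp
    finally show ?thesis .
  qed
  then have fixpoint: "(a * b + 1) * \<beta> + a = u * \<beta>" using ab by simp
  have contr: "\<bar>f (Suc (Suc n)) - \<beta>\<bar> \<le> w * \<bar>f n - \<beta>\<bar>" for n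
  proof -
    have d: "b * f n + 1 > 1" using pos[of n] ab by simp
    have "f (Suc (Suc n)) = ((a * b + 1) * f n + a) / (b * f n + 1)"
      unfolding f_step using pos[of n] d by (simp add: field_simps)
    moreover have "\<beta> = ((a * b + 1) * \<beta> + a) / (b * \<beta> + 1)"
      using fixpoint u(3) by (simp add: \<beta>)
    ultimately have "f (Suc (Suc n)) - \<beta> =
        ((a * b + 1) * f n + a) / (b * f n + 1) - ((a * b + 1) * \<beta> + a) / (b * \<beta> + 1)"
      by simp
    \<comment> \<open>Determinant 1 leaves exactly \<open>f n - \<beta>\<close> in the numerator. Of
      the two denominators, one equals \<open>u\<close> and the other exceeds 1.\<close>
    also have "\<dots> = (f n - \<beta>) / ((b * f n + 1) * (b * \<beta> + 1))"
    proof -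
      have "b * f n + 1 \<noteq> 0" "b * \<beta> + 1 \<noteq> 0" using d u(3) \<beta>(2) by linarith+
      then show ?thesis by (simp add: diff_frac_eq) (simp add: algebra_simps)
    qed
    finally have "\<bar>f (Suc (Suc n)) - \<beta>\<bar> = \<bar>f n - \<beta>\<bar> / (b * f n + 1) * w"
      using d u(3) by (simp add: \<beta>(2) w abs_mult)
    also have "\<dots> \<le> \<bar>f n - \<beta>\<bar> / 1 * w"
      using d w by (intro mult_right_mono divide_left_mono) auto
    finally show ?thesis by (simp add: mult.commute)
  qed
  \<comment> \<open>The contraction links indices of equal parity, so \<open>K\<close> has to
    dominate both initial errors.\<close>
  define K where "K = \<bar>f 0 - \<beta>\<bar> + \<bar>f 1 - \<beta>\<bar>"
  have bound: "\<bar>f n - \<beta>\<bar> \<le> K * w ^ (n div 2)" for n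
  proof (induction n rule: induct_nat_012)
    case (ge2 n)
    show ?case
      using contr[of n] mult_left_mono[OF ge2(1), of w] w by (simp add: mult.left_commute)
  qed (auto simp: K_def)
  have "(\<lambda>n. w ^ (n div 2)) \<longlonglongrightarrow> 0"
  proof (rule filterlim_compose[of "\<lambda>n. w ^ n"])
    show "(\<lambda>n. w ^ n) \<longlonglongrightarrow> 0" using w by (intro LIMSEQ_realpow_zero) auto
    show "filterlim (\<lambda>n::nat. n div 2) at_top at_top"
      by (rule filterlim_at_top_div_const_nat) simp
  qed
  then have "(\<lambda>n. K * w ^ (n div 2)) \<longlonglongrightarrow> 0"
    by (rule tendsto_mult_right_zero)
  then have "(\<lambda>n. f n - \<beta>) \<longlonglongrightarrow> 0"
    by (rule tendsto_0_le[where K = 1])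
      (use bound in \<open>auto intro!: always_eventually order_trans[OF _ abs_ge_self]\<close>)
  then have "f \<longlonglongrightarrow> \<beta>" by (simp add: LIM_zero_iff)
  then show ?thesis unfolding cfrac_def f_def \<beta>_def by (rule limI)
qed

section \<open>The spectrum of the period matrix and the final identity\<close>

lemma eigenvalue_mat2:
  fixes x y z t k :: "'a :: field"
  assumes "z \<noteq> 0"
  shows "eigenvalue (mat_of_rows_list 2 [[x, y], [z, t]]) k \<longleftrightarrow> (k - x) * (k - t) = y * z"
proof -
  let ?A = "mat_of_rows_list 2 [[x, y], [z, t]]"
  have all2: "(\<forall>i<2. P i) \<longleftrightarrow> P 0 \<and> P 1" for P :: "nat \<Rightarrow> bool"
    by (auto simp: less_2_cases_iff)
  have eq: "?A *\<^sub>v v = k \<cdot>\<^sub>v v \<longleftrightarrow> x * v $ 0 + y * v $ 1 = k * v $ 0 \<and> z * v $ 0 + t * v $ 1 = k * v $ 1"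
    if "v \<in> carrier_vec 2" for v
  proof -
    have "(?A *\<^sub>v v) $ 0 = x * v $ 0 + y * v $ 1" "(?A *\<^sub>v v) $ 1 = z * v $ 0 + t * v $ 1"
      using that by (simp_all add: mat_of_rows_list_def scalar_prod_def numeral_2_eq_2)
    moreover have "dim_vec (?A *\<^sub>v v) = 2" by (simp add: mat_of_rows_list_def)
    ultimately show ?thesis using that by (simp add: vec_eq_iff all2)
  qed
  have nz: "v \<noteq> 0\<^sub>v 2 \<longleftrightarrow> v $ 0 \<noteq> 0 \<or> v $ 1 \<noteq> 0" if "v \<in> carrier_vec 2" for v :: "'a vec"
    using that by (simp add: vec_eq_iff all2)
  have dim: "dim_row ?A = 2" by (simp add: mat_of_rows_list_def)
  show ?thesis
  proof
    assume "eigenvalue ?A k"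
    then obtain v where v: "v \<in> carrier_vec 2" "v \<noteq> 0\<^sub>v 2" "?A *\<^sub>v v = k \<cdot>\<^sub>v v"
      unfolding eigenvalue_def eigenvector_def dim by blast
    then have e: "y * v $ 1 = (k - x) * v $ 0" "z * v $ 0 = (k - t) * v $ 1"
      by (simp_all add: eq algebra_simps)
    \<comment> \<open>If the second coordinate were 0, the second row and
      \<open>z \<noteq> 0\<close> would force the first to be 0 as well.\<close>
    have "v $ 1 \<noteq> 0"
    proof
      assume "v $ 1 = 0"
      moreover from this have "v $ 0 = 0" using e(2) assms by simp
      ultimately show False using nz[OF v(1)] v(2) by simp
    qed
    have "z * ((k - x) * v $ 0) = z * y * v $ 1" using e(1) by simp
    moreover have "z * ((k - x) * v $ 0) = (k - x) * (k - t) * v $ 1"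
      using e(2) by (simp add: mult.left_commute)
    ultimately show "(k - x) * (k - t) = y * z"
      using \<open>v $ 1 \<noteq> 0\<close> by (simp add: mult.commute)
  next
    assume k: "(k - x) * (k - t) = y * z"
    \<comment> \<open>This vector solves the second row identically; the first row then becomes the
      characteristic equation.\<close>
    define v where "v = vec 2 (\<lambda>i. if i = 0 then k - t else z)"
    have v: "v \<in> carrier_vec 2" "v $ 0 = k - t" "v $ 1 = z" by (simp_all add: v_def)
    have "x * (k - t) + y * z = k * (k - t)" "z * (k - t) + t * z = k * z"
      using k[symmetric] by (simp_all add: algebra_simps)
    then have "?A *\<^sub>v v = k \<cdot>\<^sub>v v"
      unfolding eq[OF v(1)] v(2,3) by blast
    moreover have "v \<noteq> 0\<^sub>v 2"
      unfolding nz[OF v(1)] v(2,3) using assms by blast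
    ultimately have "eigenvector ?A v k"
      unfolding eigenvector_def dim using v(1) by blast
    then show "eigenvalue ?A k" unfolding eigenvalue_def by blast
  qed
qed

theorem corollary1p6:
  fixes a b :: nat and c p q :: "nat \<Rightarrow> nat" and \<alpha> :: real and A :: "real mat"
  assumes "a > 0" and "b > 0"
    and c_def: "c = periodic2 a b"
    and \<alpha>_def: "\<alpha> = cfrac c"
    and p_def: "p = conv_num c"
    and q_def: "q = conv_denom c"
    and A_def: "A = mat_of_rows_list 2 [[real (a * b + 1), real a], [real b, 1]]"
  shows "A = mat_of_rows_list 2 [[real (p 1), real (p 0)], [real (q 1), real (q 0)]] \<and>
    (\<exists>u. spectrum A = {u, 1 / u} \<and> u > 1 / u) \<and>
    (\<forall>u. spectrum A = {u, 1 / u} \<and> u > 1 / u \<longrightarrow>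
       rogers_dilog (1 / (real b * \<alpha> + 1)\<^sup>2) = rogers_dilog (1 / u\<^sup>2) \<and>
       (\<lambda>n. rogers_dilog ((real b / real (q (2 * (n + 2) - 1)))\<^sup>2)) sums rogers_dilog (1 / u\<^sup>2))"
proof -
  define T where "T = real (a * b + 2)"
  have T: "T > 2" using assms(1,2) by (simp add: T_def)
  have spec: "k \<in> spectrum A \<longleftrightarrow> k * k + 1 = T * k" for k
    using assms(2) by (auto simp: spectrum_def A_def eigenvalue_mat2 T_def algebra_simps)
  \<comment> \<open>The condition \<open>u > 1 / u\<close> alone also admits
    \<open>-1 < u < 0\<close>; the positive trace excludes that range.\<close>
  have eig: "u * (1 / u) = 1 \<and> u + 1 / u = T \<and> 1 < u" if "spectrum A = {u, 1 / u}" "u > 1 / u" for u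
  proof -
    have eq: "u * u + 1 = T * u" using spec[of u] that by simp
    then have "u \<noteq> 0" by auto
    with eq have sum: "u + 1 / u = T" by (simp add: field_simps)
    have "u > 0" using sum T that(2) by linarith
    moreover have "u > 1"
    proof (rule ccontr)
      assume "\<not> u > 1"
      then have "1 \<le> 1 / u" using \<open>u > 0\<close> by simp
      then show False using that(2) \<open>\<not> u > 1\<close> by linarith
    qed
    ultimately show ?thesis using sum by simp
  qed
  have "A = mat_of_rows_list 2 [[real (p 1), real (p 0)], [real (q 1), real (q 0)]]"
    by (simp add: A_def p_def q_def c_def conv_num_def conv_denom_def periodic2_def numeral_2_eq_2
        numeral_3_eq_3 algebra_simps)
  moreover have "\<exists>u. spectrum A = {u, 1 / u} \<and> u > 1 / u"
  proof -
    \<comment> \<open>The square root of the discriminant of \<open>k * k - T * k + 1\<close>. The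
      conjugate root is \<open>1 / u\<close> because \<open>(T + d) * (T - d) = 4\<close>.\<close>
    define d where "d = sqrt (T\<^sup>2 - 4)"
    have "T\<^sup>2 > 2\<^sup>2" using T by (intro power_strict_mono) auto
    then have d: "d > 0" "d * d = T * T - 4" by (simp_all add: d_def power2_eq_square)
    define u where "u = (T + d) / 2"
    have "u > 0" using T d by (simp add: u_def)
    have inv: "1 / u = (T - d) / 2"
      using \<open>u > 0\<close> d by (simp add: u_def field_simps)
    have "k * k + 1 = T * k \<longleftrightarrow> (k - u) * (k - 1 / u) = 0" for k
      unfolding inv unfolding u_def using d(2) by (auto simp: field_simps)
    then have "spectrum A = {u, 1 / u}" using spec by auto
    moreover have "u > 1 / u" using d by (simp add: inv) (simp add: u_def)
    ultimately show ?thesis by blast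
  qed
  moreover have "rogers_dilog (1 / (real b * \<alpha> + 1)\<^sup>2) = rogers_dilog (1 / u\<^sup>2) \<and>
       (\<lambda>n. rogers_dilog ((real b / real (q (2 * (n + 2) - 1)))\<^sup>2)) sums rogers_dilog (1 / u\<^sup>2)"
    if "spectrum A = {u, 1 / u}" "u > 1 / u" for u
  proof
    define w where "w = 1 / u"
    have u: "u * w = 1" "u + w = real (a * b + 2)" "1 < u"
      using eig[OF that] unfolding w_def T_def by auto
    have "\<alpha> = (u - 1) / b"
      unfolding \<alpha>_def c_def by (rule cfrac_periodic2[OF assms(1,2) u])
    then show "rogers_dilog (1 / (real b * \<alpha> + 1)\<^sup>2) = rogers_dilog (1 / u\<^sup>2)"
      using assms(2) by simp
    have w: "0 < w" "w < 1" using u(3) by (simp_all add: w_def)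
    \<comment> \<open>This identifies the arguments with those of \<open>rogers_dilog_sums\<close>
      at \<open>x = w\<^sup>2\<close>.\<close>
    have "(b / q (2 * (n + 2) - 1))\<^sup>2 = (w\<^sup>2) ^ Suc n * ((1 - w\<^sup>2) / (1 - (w\<^sup>2) ^ (n + 2)))\<^sup>2" for n
    proof -
      define Q W where "Q = real (q (2 * (n + 2) - 1))" and "W = w ^ (n + 2)"
      have "W\<^sup>2 < 1"
        using w by (simp add: W_def power_less_one_iff del: power_Suc add_2_eq_Suc' flip: power_mult)
      have uW: "u ^ (n + 2) * W = 1"
        unfolding W_def power_mult_distrib[symmetric] u(1) by simp
      \<comment> \<open>Binet's formula is turned into one in powers of \<open>w\<close> only:
        \<open>u * w = 1\<close> gives \<open>1 - w\<^sup>2 = (u - w) * w\<close>, and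
        multiplication by \<open>W\<close> removes the power of \<open>u\<close>.\<close>
      have "(1 - w\<^sup>2) * w ^ Suc n = (u * w - w\<^sup>2) * w ^ Suc n"
        unfolding u(1) ..
      also have "\<dots> = (u - w) * W"
        by (simp add: W_def algebra_simps power2_eq_square)
      finally have "Q * ((1 - w\<^sup>2) * w ^ Suc n) = Q * (u - w) * W"
        by (simp only: mult.assoc)
      also have "Q * (u - w) = b * (u ^ (n + 2) - W)"
        using conv_denom_periodic2[OF u(1,2), of "Suc n"] by (simp add: Q_def W_def q_def c_def)
      also have "b * (u ^ (n + 2) - W) * W = b * (u ^ (n + 2) * W - W\<^sup>2)"
        by (simp only: power2_eq_square left_diff_distrib mult.assoc)
      finally have eq: "Q * ((1 - w\<^sup>2) * w ^ Suc n) = b * (1 - W\<^sup>2)"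
        unfolding uW .
      moreover have "b * (1 - W\<^sup>2) > 0" using assms(2) \<open>W\<^sup>2 < 1\<close> by simp
      \<comment> \<open>The right-hand side of \<open>eq\<close> is positive, so the denominator
        cannot vanish.\<close>
      ultimately have "Q \<noteq> 0" by auto
      with eq \<open>W\<^sup>2 < 1\<close> have "b / Q = w ^ Suc n * ((1 - w\<^sup>2) / (1 - W\<^sup>2))"
        by (simp add: nonzero_divide_eq_eq nonzero_eq_divide_eq mult_ac)
      then have "(b / Q)\<^sup>2 = (w ^ Suc n)\<^sup>2 * ((1 - w\<^sup>2) / (1 - W\<^sup>2))\<^sup>2"
        by (simp only: power_mult_distrib)
      also have "(w ^ Suc n)\<^sup>2 = (w\<^sup>2) ^ Suc n"
        by (simp only: mult.commute flip: power_mult)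
      also have "W\<^sup>2 = (w\<^sup>2) ^ (n + 2)"
        unfolding W_def by (simp only: mult.commute flip: power_mult)
      finally show ?thesis unfolding Q_def .
    qed
    moreover have "1 / u\<^sup>2 = w\<^sup>2" by (simp add: w_def power_divide)
    moreover have "0 < w\<^sup>2" "w\<^sup>2 < 1" using w by (simp_all add: power_less_one_iff)
    ultimately show "(\<lambda>n. rogers_dilog ((real b / real (q (2 * (n + 2) - 1)))\<^sup>2)) sums rogers_dilog (1 / u\<^sup>2)"
      using rogers_dilog_sums[of "w\<^sup>2"] by simp
  qed
  ultimately show ?thesis by blast
qed

end
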